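(* Local $2$-FWL, denoted $2$-FWL$_L$, has stronger link discriminating power than local $2$-WL, denoted $2$-WL$_L$. That is: (i) for all finite undirected node-labeled graphs $G=(V,E,l)$, $G'=(V',E',l')$ and all target links $e\in V\times V$, $e'\in V'\times V'$, if $2$-WL$_L$ distinguishes $(e,G)$ and $(e',G')$, then $2$-FWL$_L$ distinguishes $(e,G)$ and $(e',G')$; and (ii) there exist graphs $G_1,G_1'$ and target links $e_1,e_1'$ in them such that $2$-FWL$_L$ distinguishes $(e_1,G_1)$ and $(e_1',G_1')$ but $2$-WL$_L$ does not.
   Context: Graphs. A labeled graph is $G=(V,E,l)$ with finite node set $V=[n]=\{1,\dots,n\}$, edge set $E\subseteq V\times V$ (undirected, i.e. $E$ is symmetric), and $l:V\to\Sigma$ a node labeling in a label set $\Sigma$. A link is an ordered pair $e=(p,q)\in V\times V$. Multisets are written $\{\!\!\{\cdot\}\!\!\}$. Standing assumption. The target links being compared have unknown edge status: their edge-existence indicator is set to $0$, i.e. target links $e$ in $G$ and $e'$ in $G'$ satisfy $e\notin E$, $e'\notin E'$ (the target link is not part of the observed graph). Both tests assign colors to all pairs in $V\times V$, with initial color $c^{(0)}(p,q)=\big(l(p),l(q),\mathbf 1[(p,q)\in E]\big)$. For $t\ge1$ the updates are as follows, where $f$ and $f_F$ are fixed injective functions (the same for all graphs). Local $2$-WL ($2$-WL$_L$): $$c^{(t)}(p,q)=f\Big(c^{(t-1)}(p,q),\ \{\!\!\{c^{(t-1)}(u,q): u\in V,\,(u,q)\in E\}\!\!\},\ \{\!\!\{c^{(t-1)}(p,v):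 v\in V,\,(p,v)\in E\}\!\!\}\Big).$$ Local $2$-FWL ($2$-FWL$_L$): $$c^{(t)}(p,q)=f_F\Big(c^{(t-1)}(p,q),\ \{\!\!\{\big(c^{(t-1)}(u,q),c^{(t-1)}(p,u)\big): u\in V,\ (u,q)\in E\text{ or }(p,u)\in E\}\!\!\}\Big).$$ Each test distinguishes $(e,G)$ and $(e',G')$ unless its own colors satisfy $c^{(t)}(e)=c^{(t)}(e')$ for all $t\ge0$. *)

theory Defs
  imports "HOL-Library.Multiset"
begin

text \<open>
  A labeled graph on the node set \<open>{1..n}\<close>; the label set is the type \<open>'l\<close>.  Values of the
  labeling outside the node set are irrelevant.
\<close>

record 'l lgraph =
  num_nodes :: nat
  edges :: "(nat \<times> nat) set"
  label :: "nat \<Rightarrow> 'l"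

definition nodes :: "'l lgraph \<Rightarrow> nat set" where
  "nodes G = {1..num_nodes G}"

definition undirected_lgraph :: "'l lgraph \<Rightarrow> bool" where
  "undirected_lgraph G \<longleftrightarrow> edges G \<subseteq> nodes G \<times> nodes G \<and> sym (edges G)"

text \<open>
  The edge status of a target link is unknown, so the link is absent from the observed graph
  and its indicator is \<open>False\<close>.
\<close>

definition target_link :: "'l lgraph \<Rightarrow> nat \<times> nat \<Rightarrow> bool" where
  "target_link G e \<longleftrightarrow> e \<in> nodes G \<times> nodes G \<and> e \<notin> edges G"

text \<open>
  Colors live in a type \<open>'c\<close> that contains the initial colors through an injection \<open>\<iota>\<close>, so
  that one function \<open>f\<close> can be applied to the colors of every round.
\<close>

fun local_2wl ::
  "('l \<times> 'l \<times> bool \<Rightarrow> 'c) \<Rightarrow> ('c \<times> 'c multiset \<times> 'c multiset \<Rightarrow> 'c) \<Rightarrow>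
   'l lgraph \<Rightarrow> nat \<Rightarrow> nat \<times> nat \<Rightarrow> 'c" where
  "local_2wl \<iota> f G 0 (p, q) = \<iota> (label G p, label G q, (p, q) \<in> edges G)"
| "local_2wl \<iota> f G (Suc t) (p, q) =
     f (local_2wl \<iota> f G t (p, q),
        image_mset (\<lambda>u. local_2wl \<iota> f G t (u, q)) (mset_set {u \<in> nodes G. (u, q) \<in> edges G}),
        image_mset (\<lambda>v. local_2wl \<iota> f G t (p, v)) (mset_set {v \<in> nodes G. (p, v) \<in> edges G}))"

fun local_2fwl ::
  "('l \<times> 'l \<times> bool \<Rightarrow> 'c) \<Rightarrow> ('c \<times> ('c \<times> 'c) multiset \<Rightarrow> 'c) \<Rightarrow>
   'l lgraph \<Rightarrow> nat \<Rightarrow> nat \<times> nat \<Rightarrow> 'c" where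
  "local_2fwl \<iota> f\<^sub>F G 0 (p, q) = \<iota> (label G p, label G q, (p, q) \<in> edges G)"
| "local_2fwl \<iota> f\<^sub>F G (Suc t) (p, q) =
     f\<^sub>F (local_2fwl \<iota> f\<^sub>F G t (p, q),
         image_mset (\<lambda>u. (local_2fwl \<iota> f\<^sub>F G t (u, q), local_2fwl \<iota> f\<^sub>F G t (p, u)))
           (mset_set {u \<in> nodes G. (u, q) \<in> edges G \<or> (p, u) \<in> edges G}))"

definition local_2wl_distinguishes ::
  "('l \<times> 'l \<times> bool \<Rightarrow> 'c) \<Rightarrow> ('c \<times> 'c multiset \<times> 'c multiset \<Rightarrow> 'c) \<Rightarrow>
   nat \<times> nat \<Rightarrow> 'l lgraph \<Rightarrow> nat \<times> nat \<Rightarrow> 'l lgraph \<Rightarrow> bool" where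
  "local_2wl_distinguishes \<iota> f e G e' G' \<longleftrightarrow>
     \<not> (\<forall>t. local_2wl \<iota> f G t e = local_2wl \<iota> f G' t e')"

definition local_2fwl_distinguishes ::
  "('l \<times> 'l \<times> bool \<Rightarrow> 'c) \<Rightarrow> ('c \<times> ('c \<times> 'c) multiset \<Rightarrow> 'c) \<Rightarrow>
   nat \<times> nat \<Rightarrow> 'l lgraph \<Rightarrow> nat \<times> nat \<Rightarrow> 'l lgraph \<Rightarrow> bool" where
  "local_2fwl_distinguishes \<iota> f\<^sub>F e G e' G' \<longleftrightarrow>
     \<not> (\<forall>t. local_2fwl \<iota> f\<^sub>F G t e = local_2fwl \<iota> f\<^sub>F G' t e')"

text \<open>
  For every label type there is a color type with injective \<open>\<iota>\<close>, \<open>f\<close> and \<open>f\<^sub>F\<close>, namely the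
  free one, so assuming injectivity is not vacuous.
\<close>

datatype 'l free_color =
    Initial "'l \<times> 'l \<times> bool"
  | Hash "'l free_color \<times> 'l free_color multiset \<times> 'l free_color multiset"
  | Hash_F "'l free_color \<times> ('l free_color \<times> 'l free_color) multiset"

lemma free_color_injective: "inj Initial" "inj Hash" "inj Hash_F"
  by (simp_all add: inj_def)

end

theory Submission imports Defs begin

text \<open>
  Every color of \<open>2\<close>-FWL\<open>\<^sub>L\<close> remembers the initial color, hence the edge status of its pair.  So in the
  multiset of pairs \<open>(c (u, q), c (p, u))\<close> one can single out those with \<open>(u, q) \<in> E\<close> and those
  with \<open>(p, u) \<in> E\<close>, and recover the two multisets of \<open>2\<close>-WL\<open>\<^sub>L\<close>.  Conversely, on an unlabeled
  regular graph \<open>2\<close>-WL\<open>\<^sub>L\<close> sees nothing but the edge status of a pair, whereas \<open>2\<close>-FWL\<open>\<^sub>L\<close> counts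
  \<open>N(p) \<union> N(q)\<close>, which separates distance two from distance three in a hexagon.
\<close>

lemma finite_nodes [simp]: "finite (nodes G)"
  by (simp add: nodes_def)

text \<open>Undoing the injective \<open>f\<^sub>F\<close> exposes the previous color as first
  component, so after \<open>t\<close> steps the initial color is back, and its last entry is the
  edge indicator. The decoder \<open>b\<close> is chosen before the graph, so it reads colors of all
  graphs alike.\<close>

lemma local_2fwl_determines_edge:
  fixes \<iota> :: "'l \<times> 'l \<times> bool \<Rightarrow> 'c"
  assumes "inj \<iota>" and "inj f\<^sub>F"
  shows "\<exists>b. \<forall>(G :: 'l lgraph) p q. b (local_2fwl \<iota> f\<^sub>F G t (p, q)) \<longleftrightarrow> (p, q) \<in> edges G"
proof (induction t)
  case 0
  show ?case
    by (rule exI[of _ "\<lambda>c. snd (snd (inv \<iota> c))"]) (simp add: assms)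
next
  case (Suc t)
  then obtain b where
    "\<forall>(G :: 'l lgraph) p q. b (local_2fwl \<iota> f\<^sub>F G t (p, q)) \<longleftrightarrow> (p, q) \<in> edges G" ..
  then show ?case
    by (intro exI[of _ "\<lambda>c. b (fst (inv f\<^sub>F c))"]) (simp add: assms)
qed

text \<open>As \<open>h\<close> does not depend on the graph, pairs in two different graphs that
  agree under \<open>local_2fwl\<close> in round \<open>t\<close> also agree under
  \<open>local_2wl\<close>; part (i) is the contrapositive.\<close>

lemma local_2fwl_determines_local_2wl:
  fixes \<iota> :: "'l \<times> 'l \<times> bool \<Rightarrow> 'c"
  assumes "inj \<iota>" and "inj f\<^sub>F"
  shows "\<exists>h. \<forall>(G :: 'l lgraph) e. local_2wl \<iota> f G t e = h (local_2fwl \<iota> f\<^sub>F G t e)"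
proof (induction t)
  case 0
  show ?case
    by (rule exI[of _ id]) simp
next
  case (Suc t)
  then obtain h where
    h: "\<And>(G :: 'l lgraph) e. local_2wl \<iota> f G t e = h (local_2fwl \<iota> f\<^sub>F G t e)"
    by blast
  obtain b where
    b: "\<And>(G :: 'l lgraph) p q. b (local_2fwl \<iota> f\<^sub>F G t (p, q)) \<longleftrightarrow> (p, q) \<in> edges G"
    using local_2fwl_determines_edge[OF assms] by blast
  \<comment> \<open>An entry of \<open>M\<close> holds the color of \<open>(u, q)\<close> first and
    that of \<open>(p, u)\<close> second. Filtering by \<open>b\<close> on one component keeps
    exactly the \<open>u\<close> that index the corresponding multiset of
    \<open>local_2wl\<close>.\<close>
  define k where "k = (\<lambda>(c, M).
    f (h c, image_mset (\<lambda>x. h (fst x)) (filter_mset (\<lambda>x. b (fst x)) M),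
            image_mset (\<lambda>x. h (snd x)) (filter_mset (\<lambda>x. b (snd x)) M)))"
  have "local_2wl \<iota> f G (Suc t) (p, q) = k (inv f\<^sub>F (local_2fwl \<iota> f\<^sub>F G (Suc t) (p, q)))"
    for G :: "'l lgraph" and p q
  proof -
    \<comment> \<open>Filtering \<open>mset_set\<close> yields such nested comprehensions; each
      collapses to a one-sided neighborhood.\<close>
    have 1: "{u \<in> {u \<in> nodes G. (u, q) \<in> edges G \<or> (p, u) \<in> edges G}. (u, q) \<in> edges G} =
        {u \<in> nodes G. (u, q) \<in> edges G}"
      and 2: "{u \<in> {u \<in> nodes G. (u, q) \<in> edges G \<or> (p, u) \<in> edges G}. (p, u) \<in> edges G} =
        {u \<in> nodes G. (p, u) \<in> edges G}"
      by auto
    show ?thesis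
      by (simp add: k_def h b assms filter_mset_image_mset 1 2
          image_mset.compositionality comp_def del: mem_Collect_eq)
  qed
  then show ?case
    by (intro exI[of _ "\<lambda>c. k (inv f\<^sub>F c)"]) auto
qed

lemma local_2wl_distinguishes_imp_local_2fwl_distinguishes:
  assumes "inj \<iota>" and "inj f\<^sub>F" and "local_2wl_distinguishes \<iota> f e G e' G'"
  shows "local_2fwl_distinguishes \<iota> f\<^sub>F e G e' G'"
  using assms local_2fwl_determines_local_2wl[OF assms(1,2), of f]
  unfolding local_2wl_distinguishes_def local_2fwl_distinguishes_def by metis

text \<open>Both multisets in an update range over edges only. By induction all edges share one
  color, so each multiset consists of \<open>d\<close> copies of it, whatever the pair, and no new
  information ever arises.\<close>

lemma local_2wl_regular:
  assumes "undirected_lgraph G"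
    and regular: "\<And>p. p \<in> nodes G \<Longrightarrow> card {u \<in> nodes G. (u, p) \<in> edges G} = d"
    and unlabeled: "\<And>p. label G p = a"
    and "{p, q, p', q'} \<subseteq> nodes G"
    and "(p, q) \<in> edges G \<longleftrightarrow> (p', q') \<in> edges G"
  shows "local_2wl \<iota> f G t (p, q) = local_2wl \<iota> f G t (p', q')"
  using assms(4,5)
proof (induction t arbitrary: p q p' q')
  case 0
  then show ?case by (simp add: unlabeled)
next
  case (Suc t)
  have sym: "(u, v) \<in> edges G \<longleftrightarrow> (v, u) \<in> edges G" for u v
    using assms(1) by (auto simp: undirected_lgraph_def dest: symD)
  have regular': "card {v \<in> nodes G. (r, v) \<in> edges G} = d" if "r \<in> nodes G" for r
    using regular[OF that] by (simp add: sym[of r])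
  \<comment> \<open>If every value of \<open>g\<close> on \<open>A\<close> equals every value of
    \<open>g'\<close> on \<open>A'\<close>, both images repeat a single value. The empty case is
    split off because it offers no element to name that value.\<close>
  have const: "image_mset g (mset_set A) = image_mset g' (mset_set A')"
    if *: "card A = card A'" "\<And>x y. x \<in> A \<Longrightarrow> y \<in> A' \<Longrightarrow> g x = g' y" "finite A" "finite A'"
    for g g' :: "nat \<Rightarrow> 'b" and A A' :: "nat set"
  proof (cases "A = {}")
    case True
    then show ?thesis using * by simp
  next
    case False
    then have "A' \<noteq> {}"
      using * by auto
    then obtain y where y: "y \<in> A'" by blast
    from False obtain x where x: "x \<in> A" by blast
    have "image_mset g (mset_set A) = image_mset (\<lambda>_. g' y) (mset_set A)"
      using * y by (intro image_mset_cong) simp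
    moreover have "image_mset g' (mset_set A') = image_mset (\<lambda>_. g x) (mset_set A')"
      using * x by (intro image_mset_cong) simp
    ultimately show ?thesis
      using * x y by (simp add: image_mset_const_eq)
  qed
  have "image_mset (\<lambda>u. local_2wl \<iota> f G t (u, q)) (mset_set {u \<in> nodes G. (u, q) \<in> edges G}) =
      image_mset (\<lambda>u. local_2wl \<iota> f G t (u, q')) (mset_set {u \<in> nodes G. (u, q') \<in> edges G})"
    using Suc.prems by (intro const Suc.IH) (simp_all add: regular)
  moreover have
    "image_mset (\<lambda>v. local_2wl \<iota> f G t (p, v)) (mset_set {v \<in> nodes G. (p, v) \<in> edges G}) =
      image_mset (\<lambda>v. local_2wl \<iota> f G t (p', v)) (mset_set {v \<in> nodes G. (p', v) \<in> edges G})"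
    using Suc.prems by (intro const Suc.IH) (simp_all add: regular')
  ultimately show ?case
    using Suc.IH[OF Suc.prems] by simp
qed

text \<open>The label type is arbitrary, so \<open>undefined\<close> serves as the constant
  label.\<close>

definition hexagon :: "'l lgraph" where
  "hexagon = \<lparr>num_nodes = 6,
     edges = (let C = {(1, 2), (2, 3), (3, 4), (4, 5), (5, 6), (6, 1)} in C \<union> C\<inverse>),
     label = \<lambda>_. undefined\<rparr>"

lemma nodes_hexagon: "nodes hexagon = {1, 2, 3, 4, 5, 6}"
  by (auto simp: nodes_def hexagon_def)

lemma edges_hexagon:
  "edges hexagon = {(1, 2), (2, 3), (3, 4), (4, 5), (5, 6), (6, 1),
     (2, 1), (3, 2), (4, 3), (5, 4), (6, 5), (1, 6)}"
  by (auto simp: hexagon_def)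

lemma label_hexagon: "label hexagon p = undefined"
  by (simp add: hexagon_def)

lemma undirected_hexagon: "undirected_lgraph hexagon"
  unfolding undirected_lgraph_def nodes_hexagon edges_hexagon by (auto intro!: symI)

lemma regular_hexagon:
  assumes "p \<in> nodes (hexagon :: 'l lgraph)"
  shows "card {u \<in> nodes (hexagon :: 'l lgraph). (u, p) \<in> edges (hexagon :: 'l lgraph)} = 2"
proof -
  let ?H = "hexagon :: 'l lgraph"
  have "{u \<in> nodes ?H. (u, 1) \<in> edges ?H} = {2, 6}"
    "{u \<in> nodes ?H. (u, 2) \<in> edges ?H} = {1, 3}"
    "{u \<in> nodes ?H. (u, 3) \<in> edges ?H} = {2, 4}"
    "{u \<in> nodes ?H. (u, 4) \<in> edges ?H} = {3, 5}"
    "{u \<in> nodes ?H. (u, 5) \<in> edges ?H} = {4, 6}"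
    "{u \<in> nodes ?H. (u, 6) \<in> edges ?H} = {5, 1}"
    by (auto simp: nodes_hexagon edges_hexagon)
  moreover have "p = 1 \<or> p = 2 \<or> p = 3 \<or> p = 4 \<or> p = 5 \<or> p = 6"
    using assms by (simp add: nodes_hexagon)
  ultimately show ?thesis by (elim disjE) (simp_all only:, simp_all)
qed

lemma target_link_hexagon: "target_link hexagon (1, 3)" "target_link hexagon (1, 4)"
  by (simp_all add: target_link_def nodes_hexagon edges_hexagon)

text \<open>One round suffices: nodes 1 and 3 share the neighbor 2, so their neighborhoods have a
  union of size three, while those of the opposite nodes 1 and 4 are disjoint and give four.\<close>

lemma local_2fwl_distinguishes_hexagon:
  fixes \<iota> :: "'l \<times> 'l \<times> bool \<Rightarrow> 'c"
  assumes "inj f\<^sub>F"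
  shows "local_2fwl_distinguishes \<iota> f\<^sub>F (1, 3) hexagon (1, 4) hexagon"
proof -
  let ?H = "hexagon :: 'l lgraph"
  have neighbors: "{u \<in> nodes ?H. (u, 3) \<in> edges ?H \<or> (1, u) \<in> edges ?H} = {2, 4, 6}"
    "{u \<in> nodes ?H. (u, 4) \<in> edges ?H \<or> (1, u) \<in> edges ?H} = {2, 3, 5, 6}"
    by (auto simp: nodes_hexagon edges_hexagon)
  \<comment> \<open>With \<open>g\<close> and \<open>g'\<close> arbitrary, only cardinalities are
    compared and no color has to be computed.\<close>
  have sizes: "image_mset g (mset_set {2, 4, 6}) \<noteq> image_mset g' (mset_set {2, 3, 5, 6})"
    for g g' :: "nat \<Rightarrow> 'b"
  proof
    assume "image_mset g (mset_set {2, 4, 6}) = image_mset g' (mset_set {2, 3, 5, 6})"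
    then have "size (image_mset g (mset_set {2, 4, 6})) =
        size (image_mset g' (mset_set {2, 3, 5, 6}))"
      by (rule arg_cong)
    then show False by simp
  qed
  have "local_2fwl \<iota> f\<^sub>F ?H (Suc 0) (1, 3) \<noteq> local_2fwl \<iota> f\<^sub>F ?H (Suc 0) (1, 4)"
    by (simp only: neighbors sizes local_2fwl.simps inj_eq[OF assms] prod.inject simp_thms)
  then show ?thesis
    unfolding local_2fwl_distinguishes_def by blast
qed

lemma not_local_2wl_distinguishes_hexagon:
  "\<not> local_2wl_distinguishes \<iota> f (1, 3) hexagon (1, 4) hexagon"
proof -
  have "local_2wl \<iota> f hexagon t (1, 3) = local_2wl \<iota> f hexagon t (1, 4)" for t
    by (rule local_2wl_regular[OF undirected_hexagon regular_hexagon label_hexagon])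
      (simp_all add: nodes_hexagon edges_hexagon)
  then show ?thesis
    by (simp add: local_2wl_distinguishes_def)
qed

theorem theorem4p4:
  fixes \<iota> :: "'l \<times> 'l \<times> bool \<Rightarrow> 'c"
    and f :: "'c \<times> 'c multiset \<times> 'c multiset \<Rightarrow> 'c"
    and f\<^sub>F :: "'c \<times> ('c \<times> 'c) multiset \<Rightarrow> 'c"
  assumes "inj \<iota>" and "inj f" and "inj f\<^sub>F"
  shows "(\<forall>(G :: 'l lgraph) (G' :: 'l lgraph) e e'.
            undirected_lgraph G \<and> undirected_lgraph G' \<and> target_link G e \<and> target_link G' e' \<and>
            local_2wl_distinguishes \<iota> f e G e' G' \<longrightarrow>
            local_2fwl_distinguishes \<iota> f\<^sub>F e G e' G')
       \<and> (\<exists>(G\<^sub>1 :: 'l lgraph) (G\<^sub>1' :: 'l lgraph) e\<^sub>1 e\<^sub>1'.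
            undirected_lgraph G\<^sub>1 \<and> undirected_lgraph G\<^sub>1' \<and> target_link G\<^sub>1 e\<^sub>1 \<and> target_link G\<^sub>1' e\<^sub>1' \<and>
            local_2fwl_distinguishes \<iota> f\<^sub>F e\<^sub>1 G\<^sub>1 e\<^sub>1' G\<^sub>1' \<and>
            \<not> local_2wl_distinguishes \<iota> f e\<^sub>1 G\<^sub>1 e\<^sub>1' G\<^sub>1')"
proof (intro conjI)
  \<comment> \<open>The hexagon serves as both graphs; only the target links differ.\<close>
  show "\<exists>(G\<^sub>1 :: 'l lgraph) (G\<^sub>1' :: 'l lgraph) e\<^sub>1 e\<^sub>1'.
      undirected_lgraph G\<^sub>1 \<and> undirected_lgraph G\<^sub>1' \<and> target_link G\<^sub>1 e\<^sub>1 \<and> target_link G\<^sub>1' e\<^sub>1' \<and>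
      local_2fwl_distinguishes \<iota> f\<^sub>F e\<^sub>1 G\<^sub>1 e\<^sub>1' G\<^sub>1' \<and>
      \<not> local_2wl_distinguishes \<iota> f e\<^sub>1 G\<^sub>1 e\<^sub>1' G\<^sub>1'"
    using undirected_hexagon local_2fwl_distinguishes_hexagon[OF \<open>inj f\<^sub>F\<close>]
      not_local_2wl_distinguishes_hexagon target_link_hexagon
    by (intro exI conjI)
qed (use assms local_2wl_distinguishes_imp_local_2fwl_distinguishes in blast)

end
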